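(* Let $W$ be a smooth threefold over $\mathbb C$ with a co-rank one foliation $\mathcal G$, let $p\in W$ have a logarithmic simple adapted chart, and write $R=\mathbb C[[x_1,x_2,x_3]]$, $f=x_1\cdots x_r$, $D_{\mathrm{inv}}=(f=0)$. Let $$\omega=u\,x_1\cdots x_r\Bigl(\sum_{i=1}^r\lambda_i\frac{dx_i}{x_i}+\sum_{j=r+1}^3h_j(x)\,dx_j\Bigr)$$ be the local generator of $\mathcal G$, where $u$ is a unit and the residues satisfy the positive non-resonance condition: $\sum_{i=1}^ra_i\lambda_i\ne0$ for every non-zero $(a_1,\dots,a_r)\in\mathbb Z_{\ge0}^r$. Then, for every closed subset $Z\subset D_{\mathrm{inv}}$, the reduced tangential arc functor centred on $Z$ coincides with the reduced arc functor of $D_{\mathrm{inv}}$ centred on $Z$. Equivalently, every reduced tangential formal arc centred on $Z$ factors through $D_{\mathrm{inv}}$, and every arc on $D_{\mathrm{inv}}$ is tangential. In particular, for $\Sigma_{\tan}=\operatorname{Sing}\mathcal G\cap|D_{\mathrm{inv}}|$, $$J_\infty^{\tan}(W,\mathcal G;\Sigma_{\tan})_{\mathrm{red}}=J_\infty(D_{\mathrm{inv}};\Sigma_{\tan})_{\mathrm{red}}.$$ (This is an equality of reduced arc functors only; no assertion is made about finite-level jet schemes.)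
   Context: A logarithmic simple adapted chart at $p$ consists of formal coordinates $x_1,x_2,x_3$ centred at $p$, a reduced invariant normal crossing divisor $D_{\mathrm{inv}}=\{x_1\cdots x_r=0\}$ with $1\le r\le3$, and a local generator $\omega$ of the displayed form with $h_j\in R$ and $\lambda_i\in\mathbb C$, $\lambda_i\neq0$, satisfying positive non-resonance. An arc is a morphism $\gamma:\operatorname{Spec}K[[t]]\to W$, $K/\mathbb C$ a field extension, i.e. in the chart a triple $(x_1(t),x_2(t),x_3(t))$ of power series; $\gamma(0)$ is the image of the closed point. It is tangential if $\gamma^*\omega=0$ (computed as a form $g(t)\,dt$). $J_\infty^{\tan}(W,\mathcal G;Z)_{\mathrm{red}}=\{\gamma\in J_\infty(W)_{\mathrm{red}}:\gamma(0)\in Z,\ \gamma^*\omega=0\}$, and $J_\infty(D_{\mathrm{inv}};Z)_{\mathrm{red}}$ consists of the arcs on $D_{\mathrm{inv}}$ with $\gamma(0)\in Z$. The functors are compared on $K[[t]]$-points for all field extensions $K/\mathbb C$. *)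

theory Defs
  imports "HOL-Computational_Algebra.Formal_Power_Series" "HOL-Algebra.Ideal"
begin

text \<open>The record of \<open>HOL-Algebra\<close> belonging to a type-class ring.\<close>

abbreviation univ_ring :: "'a::comm_ring_1 ring" where
  "univ_ring \<equiv> \<lparr>carrier = UNIV, mult = (*), one = 1, zero = 0, add = (+)\<rparr>"

text \<open>
  \<open>R = \<complex>[[x\<^sub>1,x\<^sub>2,x\<^sub>3]]\<close> is represented as \<open>\<complex>[[x\<^sub>1]][[x\<^sub>2]][[x\<^sub>3]]\<close>. The coordinates are numbered
  1, 2, 3; the value of \<open>coord\<close> at any other index is irrelevant, and the same applies to all
  other families indexed by the coordinates below.
\<close>

type_synonym fps3 = "complex fps fps fps"

definition const3 :: "complex \<Rightarrow> fps3" where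
  "const3 c = fps_const (fps_const (fps_const c))"

definition coord :: "nat \<Rightarrow> fps3" where
  "coord i =
     (if i = 1 then fps_const (fps_const fps_X)
      else if i = 2 then fps_const fps_X
      else fps_X)"

definition coeffwise :: "('a \<Rightarrow> 'b) \<Rightarrow> 'a fps \<Rightarrow> 'b fps" where
  "coeffwise g F = Abs_fps (\<lambda>n. g (fps_nth F n))"

definition partial3 :: "nat \<Rightarrow> fps3 \<Rightarrow> fps3" where
  "partial3 i F =
     (if i = 1 then coeffwise (coeffwise fps_deriv) F
      else if i = 2 then coeffwise fps_deriv F
      else fps_deriv F)"

lemma partial3_coord:
  assumes "i \<in> {1..3}" "j \<in> {1..3}"
  shows "partial3 i (coord j) = (if i = j then 1 else 0)"
proof -
  have "i = 1 \<or> i = 2 \<or> i = 3" "j = 1 \<or> j = 2 \<or> j = 3"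
    using assms by auto
  then show ?thesis
    by (auto simp: partial3_def coord_def coeffwise_def fps_eq_iff fps_X_def)
qed

text \<open>
  A formal 1-form \<open>\<omega> = \<omega>\<^sub>1 dx\<^sub>1 + \<omega>\<^sub>2 dx\<^sub>2 + \<omega>\<^sub>3 dx\<^sub>3\<close> is the family of its coefficients. It generates
  a co-rank one foliation if it is integrable (\<open>\<omega> \<and> d\<omega> = 0\<close>) and saturated (its coefficients have
  no common factor, i.e. its singular locus has codimension at least two).
\<close>

type_synonym form3 = "nat \<Rightarrow> fps3"

definition integrable_form :: "form3 \<Rightarrow> bool" where
  "integrable_form \<omega> \<longleftrightarrow>
     \<omega> 1 * (partial3 2 (\<omega> 3) - partial3 3 (\<omega> 2))
   + \<omega> 2 * (partial3 3 (\<omega> 1) - partial3 1 (\<omega> 3))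
   + \<omega> 3 * (partial3 1 (\<omega> 2) - partial3 2 (\<omega> 1)) = 0"

definition saturated_form :: "form3 \<Rightarrow> bool" where
  "saturated_form \<omega> \<longleftrightarrow> (\<forall>d. (\<forall>i\<in>{1..3}. d dvd \<omega> i) \<longrightarrow> d dvd 1)"

definition foliation_generator :: "form3 \<Rightarrow> bool" where
  "foliation_generator \<omega> \<longleftrightarrow> integrable_form \<omega> \<and> saturated_form \<omega>"

definition inv_eq :: "nat \<Rightarrow> fps3" where
  "inv_eq r = (\<Prod>i=1..r. coord i)"

text \<open>
  \<open>u x\<^sub>1\<cdots>x\<^sub>r (\<Sum>\<^sub>i\<^sub>\<le>\<^sub>r \<lambda>\<^sub>i dx\<^sub>i/x\<^sub>i + \<Sum>\<^sub>j\<^sub>>\<^sub>r h\<^sub>j dx\<^sub>j)\<close>; the quotient \<open>x\<^sub>1\<cdots>x\<^sub>r / x\<^sub>i\<close> is written as the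
  product over the remaining indices.
\<close>

definition log_form ::
  "nat \<Rightarrow> fps3 \<Rightarrow> (nat \<Rightarrow> complex) \<Rightarrow> (nat \<Rightarrow> fps3) \<Rightarrow> form3" where
  "log_form r u lam h i =
     (if i \<le> r then u * const3 (lam i) * (\<Prod>k\<in>{1..r} - {i}. coord k)
      else u * inv_eq r * h i)"

lemma log_form_mult_coord:
  assumes "i \<in> {1..r}"
  shows "coord i * log_form r u lam h i = u * inv_eq r * const3 (lam i)"
proof -
  have "inv_eq r = coord i * (\<Prod>k\<in>{1..r} - {i}. coord k)"
    unfolding inv_eq_def using assms by (intro prod.remove) auto
  then show ?thesis
    using assms by (simp add: log_form_def mult_ac)
qed

definition positive_nonresonant :: "nat \<Rightarrow> (nat \<Rightarrow> complex) \<Rightarrow> bool" where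
  "positive_nonresonant r lam \<longleftrightarrow>
     (\<forall>a :: nat \<Rightarrow> nat. (\<exists>i\<in>{1..r}. a i \<noteq> 0) \<longrightarrow> (\<Sum>i=1..r. of_nat (a i) * lam i) \<noteq> 0)"

text \<open>The underlying space of \<open>Spec R\<close>, the formal chart, with its Zariski-closed subsets.\<close>

definition Spec3 :: "fps3 set set" where
  "Spec3 = {P. primeideal P univ_ring}"

definition zero_locus :: "fps3 set \<Rightarrow> fps3 set set" where
  "zero_locus S = {P \<in> Spec3. S \<subseteq> P}"

definition zariski_closed :: "fps3 set set \<Rightarrow> bool" where
  "zariski_closed Z \<longleftrightarrow> (\<exists>S. Z = zero_locus S)"

definition D_inv :: "nat \<Rightarrow> fps3 set set" where
  "D_inv r = zero_locus {inv_eq r}"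

definition Sing :: "form3 \<Rightarrow> fps3 set set" where
  "Sing \<omega> = zero_locus (\<omega> ` {1..3})"

definition Sigma_tan :: "nat \<Rightarrow> form3 \<Rightarrow> fps3 set set" where
  "Sigma_tan r \<omega> = Sing \<omega> \<inter> D_inv r"

text \<open>
  A field extension \<open>K/\<complex>\<close> is a field together with a ring homomorphism from \<open>\<complex>\<close>. An arc
  \<open>Spec K[[t]] \<rightarrow> Spec R\<close> is given by its comorphism, a homomorphism of \<open>\<complex>\<close>-algebras
  \<open>\<gamma> : R \<rightarrow> K[[t]]\<close>; its components are \<open>x\<^sub>i(t) = \<gamma> x\<^sub>i\<close>. If it is centred at the closed point, then
  \<open>\<gamma>\<close> is local, hence continuous, and is substitution of the triple \<open>x\<^sub>i(t) \<in> t K[[t]]\<close>. Other centres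
  in \<open>Spec R\<close> are allowed as well.
\<close>

definition field_extension :: "(complex \<Rightarrow> 'k::field) \<Rightarrow> bool" where
  "field_extension \<iota> \<longleftrightarrow> \<iota> \<in> ring_hom univ_ring univ_ring"

definition arcs :: "(complex \<Rightarrow> 'k::field) \<Rightarrow> (fps3 \<Rightarrow> 'k fps) set" where
  "arcs \<iota> = {\<gamma> \<in> ring_hom univ_ring univ_ring. \<forall>c. \<gamma> (const3 c) = fps_const (\<iota> c)}"

text \<open>\<open>\<gamma>(0)\<close>: the preimage of the maximal ideal \<open>t K[[t]]\<close>.\<close>

definition arc_center :: "(fps3 \<Rightarrow> 'k::field fps) \<Rightarrow> fps3 set" where
  "arc_center \<gamma> = {a. fps_nth (\<gamma> a) 0 = 0}"

text \<open>The coefficient \<open>g(t)\<close> in \<open>\<gamma>\<^sup>*\<omega> = g(t) dt\<close>, with \<open>\<gamma>\<^sup>*(dx\<^sub>i) = x\<^sub>i'(t) dt\<close>.\<close>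

definition pullback :: "(fps3 \<Rightarrow> 'k::field fps) \<Rightarrow> form3 \<Rightarrow> 'k fps" where
  "pullback \<gamma> \<omega> = (\<Sum>i=1..3. \<gamma> (\<omega> i) * fps_deriv (\<gamma> (coord i)))"

definition J_tan :: "(complex \<Rightarrow> 'k::field) \<Rightarrow> form3 \<Rightarrow> fps3 set set \<Rightarrow> (fps3 \<Rightarrow> 'k fps) set" where
  "J_tan \<iota> \<omega> Z = {\<gamma> \<in> arcs \<iota>. arc_center \<gamma> \<in> Z \<and> pullback \<gamma> \<omega> = 0}"

text \<open>
  Arcs on \<open>D\<^sub>i\<^sub>n\<^sub>v = Spec R/(f)\<close>: homomorphisms \<open>R/(f) \<rightarrow> K[[t]]\<close>, identified with the homomorphisms from
  \<open>R\<close> that vanish on the ideal \<open>(f)\<close>.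
\<close>

definition arcs_D_inv :: "(complex \<Rightarrow> 'k::field) \<Rightarrow> nat \<Rightarrow> (fps3 \<Rightarrow> 'k fps) set" where
  "arcs_D_inv \<iota> r = {\<gamma> \<in> arcs \<iota>. \<forall>a \<in> PIdl\<^bsub>univ_ring\<^esub> (inv_eq r). \<gamma> a = 0}"

definition J_D_inv :: "(complex \<Rightarrow> 'k::field) \<Rightarrow> nat \<Rightarrow> fps3 set set \<Rightarrow> (fps3 \<Rightarrow> 'k fps) set" where
  "J_D_inv \<iota> r Z = {\<gamma> \<in> arcs_D_inv \<iota> r. arc_center \<gamma> \<in> Z}"

end

theory Submission
  imports Defs
begin

text \<open>
  Along an arc whose components \<open>y\<^sub>i = \<gamma> x\<^sub>i\<close> are all non-zero for \<open>i \<le> r\<close>, the form \<open>dx\<^sub>i/x\<^sub>i\<close> pulls back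
  to a form with a simple pole whose residue is the order of \<open>y\<^sub>i\<close>. Hence \<open>\<gamma>\<^sup>*\<omega>/(u f)\<close> has residue
  \<open>\<Sum>\<^sub>i a\<^sub>i \<lambda>\<^sub>i\<close> with \<open>a\<^sub>i = ord y\<^sub>i\<close>. If \<open>\<gamma>\<close> is centred on \<open>f = 0\<close> then some \<open>a\<^sub>i\<close> is positive, so by
  non-resonance the arc is not tangential. Conversely, on \<open>f = 0\<close> every \<open>y\<^sub>i \<cdot> \<gamma> \<omega>\<^sub>i\<close>, \<open>i \<le> r\<close>,
  vanishes, so either \<open>dy\<^sub>i\<close> or \<open>\<gamma> \<omega>\<^sub>i\<close> does.
\<close>

lemma univ_ring_hom_iff:
  "g \<in> ring_hom univ_ring univ_ring \<longleftrightarrow>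
     (\<forall>x y. g (x * y) = g x * g y) \<and> (\<forall>x y. g (x + y) = g x + g y) \<and> g 1 = 1"
  by (auto simp: ring_hom_def)

lemma univ_ring_hom_zero:
  assumes "g \<in> ring_hom univ_ring univ_ring"
  shows "g 0 = 0"
proof -
  have "g 0 + g 0 = g (0 + 0)"
    using assms unfolding univ_ring_hom_iff by metis
  then show ?thesis
    by simp
qed

lemma univ_ring_hom_sum:
  assumes "g \<in> ring_hom univ_ring univ_ring"
  shows "g (sum f A) = (\<Sum>i\<in>A. g (f i))"
proof (induction A rule: infinite_finite_induct)
  case (insert x F)
  then show ?case
    using assms by (simp add: univ_ring_hom_iff)
qed (simp_all add: univ_ring_hom_zero[OF assms])

lemma univ_ring_hom_prod:
  assumes "g \<in> ring_hom univ_ring univ_ring"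
  shows "g (prod f A) = (\<Prod>i\<in>A. g (f i))"
proof (induction A rule: infinite_finite_induct)
  case (insert x F)
  then show ?case
    using assms by (simp add: univ_ring_hom_iff)
qed (use assms in \<open>simp_all add: univ_ring_hom_iff\<close>)

lemma univ_ring_hom_of_nat:
  assumes "g \<in> ring_hom univ_ring univ_ring"
  shows "g (of_nat n) = of_nat n"
  by (induction n) (use assms in \<open>simp_all add: univ_ring_hom_zero univ_ring_hom_iff\<close>)

lemma univ_ring_hom_dvd_one:
  assumes "g \<in> ring_hom univ_ring univ_ring" "u dvd 1"
  shows "g u dvd 1"
  using assms unfolding dvd_def univ_ring_hom_iff by metis

text \<open>A non-zero \<open>x\<close> is a unit and units map to units. Applied to
  \<open>\<iota>\<close>, this brings a vanishing residue in \<open>K\<close> back to a relation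
  over the complex numbers, where non-resonance is stated.\<close>

lemma univ_ring_hom_field_eq_0_iff:
  fixes g :: "'a::field \<Rightarrow> 'b::comm_ring_1"
  assumes "g \<in> ring_hom univ_ring univ_ring"
  shows "g x = 0 \<longleftrightarrow> x = 0"
proof
  assume "g x = 0"
  show "x = 0"
  proof (rule ccontr)
    assume "x \<noteq> 0"
    then have "g x dvd 1"
      by (intro univ_ring_hom_dvd_one[OF assms]) (simp add: dvd_field_iff)
    with \<open>g x = 0\<close> show False
      by simp
  qed
qed (simp add: univ_ring_hom_zero[OF assms])

text \<open>With \<open>y = v * t^n\<close> and \<open>v\<close> a unit, the logarithmic derivative
  gives \<open>t y'/y = n + t v'/v\<close>; this is \<open>w\<close>. The factor \<open>t\<close>
  clears the simple pole, so no Laurent series are needed and the residue is a constant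
  coefficient.\<close>

lemma fps_log_deriv_residue:
  fixes y :: "'k::field fps"
  assumes "y \<noteq> 0"
  shows "\<exists>w. fps_X * fps_deriv y = y * w \<and> fps_nth w 0 = of_nat (subdegree y)"
proof -
  define n v where "n = subdegree y" and "v = unit_factor y"
  have v0: "fps_nth v 0 \<noteq> 0"
    using assms by (simp add: v_def)
  have y: "y = v * fps_X ^ n"
    unfolding n_def v_def by (metis fps_unit_factor_def subdegree_decompose)
  have X: "fps_X * fps_deriv (fps_X ^ n :: 'k fps) = fps_const (of_nat n) * fps_X ^ n"
    by (auto simp: fps_eq_iff fps_X_power_iff)
  define w where "w = fps_const (of_nat n) + fps_X * fps_deriv v * inverse v"
  have "v * inverse v = 1"
    using v0 by (simp add: inverse_mult_eq_1')
  then have "y * w = fps_const (of_nat n) * y + fps_X * fps_deriv v * fps_X ^ n"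
    unfolding w_def y by (simp add: algebra_simps)
  moreover have "fps_X * fps_deriv y = v * (fps_X * fps_deriv (fps_X ^ n)) + fps_X * fps_deriv v * fps_X ^ n"
    unfolding y by (simp add: algebra_simps)
  then have "fps_X * fps_deriv y = fps_const (of_nat n) * y + fps_X * fps_deriv v * fps_X ^ n"
    unfolding X by (simp add: y mult_ac)
  moreover have "fps_nth w 0 = of_nat n"
    by (simp add: w_def)
  ultimately show ?thesis
    unfolding n_def by metis
qed

lemma arcs_D_inv_iff: "\<gamma> \<in> arcs_D_inv \<iota> r \<longleftrightarrow> \<gamma> \<in> arcs \<iota> \<and> \<gamma> (inv_eq r) = 0"
proof -
  have "(\<forall>a \<in> PIdl\<^bsub>univ_ring\<^esub> (inv_eq r). \<gamma> a = 0) \<longleftrightarrow> \<gamma> (inv_eq r) = 0" if "\<gamma> \<in> arcs \<iota>"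
  proof
    assume "\<forall>a \<in> PIdl\<^bsub>univ_ring\<^esub> (inv_eq r). \<gamma> a = 0"
    moreover have "inv_eq r \<in> PIdl\<^bsub>univ_ring\<^esub> (inv_eq r)"
      by (auto simp: cgenideal_def intro: exI[of _ 1])
    ultimately show "\<gamma> (inv_eq r) = 0"
      by blast
  next
    assume "\<gamma> (inv_eq r) = 0"
    then show "\<forall>a \<in> PIdl\<^bsub>univ_ring\<^esub> (inv_eq r). \<gamma> a = 0"
      using that by (auto simp: cgenideal_def arcs_def univ_ring_hom_iff)
  qed
  then show ?thesis
    by (auto simp: arcs_D_inv_def)
qed

text \<open>Serves both inclusions: the right side vanishes on \<open>D_inv\<close>, and off
  \<open>D_inv\<close> it isolates the common factor of all logarithmic terms.\<close>

lemma arc_log_form_mult_coord: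
  assumes "\<gamma> \<in> arcs \<iota>" "i \<in> {1..r}"
  shows "\<gamma> (coord i) * \<gamma> (log_form r u lam h i) = \<gamma> u * \<gamma> (inv_eq r) * fps_const (\<iota> (lam i))"
proof -
  have "\<gamma> (coord i) * \<gamma> (log_form r u lam h i) = \<gamma> (coord i * log_form r u lam h i)"
    using assms(1) by (simp add: arcs_def univ_ring_hom_iff)
  also have "\<dots> = \<gamma> (u * inv_eq r * const3 (lam i))"
    by (simp add: log_form_mult_coord[OF assms(2)])
  finally show ?thesis
    using assms(1) by (simp add: arcs_def univ_ring_hom_iff)
qed

lemma pullback_log_form_on_D_inv:
  assumes "\<gamma> \<in> arcs_D_inv \<iota> r"
  shows "pullback \<gamma> (log_form r u lam h) = 0"
proof -
  have \<gamma>: "\<gamma> \<in> arcs \<iota>" "\<gamma> (inv_eq r) = 0"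
    using assms by (simp_all add: arcs_D_inv_iff)
  have "\<gamma> (log_form r u lam h i) * fps_deriv (\<gamma> (coord i)) = 0" if "i \<in> {1..3}" for i
  proof (cases "i \<le> r")
    case True
    then have "\<gamma> (coord i) * \<gamma> (log_form r u lam h i) = 0"
      using arc_log_form_mult_coord[OF \<gamma>(1)] \<gamma>(2) that by simp
    \<comment> \<open>\<open>K[[t]]\<close> is a domain, and if \<gamma> kills the coordinate then
      the derivative vanishes too.\<close>
    then show ?thesis
      by auto
  next
    case False
    then show ?thesis
      using \<gamma> by (simp add: log_form_def arcs_def univ_ring_hom_iff)
  qed
  then show ?thesis
    unfolding pullback_def by (intro sum.neutral) blast
qed

lemma tangential_arc_on_D_inv:
  assumes \<iota>: "field_extension \<iota>" and u: "u dvd 1" and "r \<le> 3"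
    and nonres: "positive_nonresonant r lam"
    and \<gamma>: "\<gamma> \<in> arcs \<iota>" and center: "inv_eq r \<in> arc_center \<gamma>"
    and tangential: "pullback \<gamma> (log_form r u lam h) = 0"
  shows "\<gamma> \<in> arcs_D_inv \<iota> r"
proof (rule ccontr)
  let ?\<omega> = "log_form r u lam h"
  assume "\<gamma> \<notin> arcs_D_inv \<iota> r"
  then have f0: "\<gamma> (inv_eq r) \<noteq> 0"
    using \<gamma> by (simp add: arcs_D_inv_iff)
  have hom: "\<gamma> \<in> ring_hom univ_ring univ_ring"
    using \<gamma> by (simp add: arcs_def)
  have \<iota>hom: "\<iota> \<in> ring_hom univ_ring univ_ring"
    using \<iota> by (simp add: field_extension_def)
  define y where "y = (\<lambda>i. \<gamma> (coord i))"
  have f: "\<gamma> (inv_eq r) = (\<Prod>i=1..r. y i)"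
    by (simp add: inv_eq_def y_def univ_ring_hom_prod[OF hom])
  have y0: "y i \<noteq> 0" if "i \<in> {1..r}" for i
    using f0 that by (auto simp: f)
  obtain w where w: "\<And>i. i \<in> {1..r} \<Longrightarrow> fps_X * fps_deriv (y i) = y i * w i"
    and w0: "\<And>i. i \<in> {1..r} \<Longrightarrow> fps_nth (w i) 0 = of_nat (subdegree (y i))"
    using fps_log_deriv_residue[OF y0] by metis
  define c where "c = \<gamma> u * \<gamma> (inv_eq r)"
  \<comment> \<open>\<open>S\<close> is \<open>t\<close> times the pullback of \<omega> divided by
    \<open>c\<close>, so its constant coefficient is the residue.\<close>
  define S where "S = (\<Sum>i=1..r. fps_const (\<iota> (lam i)) * w i)
    + fps_X * (\<Sum>i\<in>{1..3} - {1..r}. \<gamma> (h i) * fps_deriv (y i))"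
  have log_part: "fps_X * (\<gamma> (?\<omega> i) * fps_deriv (y i)) = c * (fps_const (\<iota> (lam i)) * w i)"
    if "i \<in> {1..r}" for i
  proof -
    have "fps_X * (\<gamma> (?\<omega> i) * fps_deriv (y i)) = y i * \<gamma> (?\<omega> i) * w i"
      using w[OF that] by (metis mult.assoc mult.commute)
    then show ?thesis
      using arc_log_form_mult_coord[OF \<gamma> that] by (simp add: y_def c_def mult_ac)
  qed
  have regular_part: "fps_X * (\<gamma> (?\<omega> i) * fps_deriv (y i)) = c * (fps_X * (\<gamma> (h i) * fps_deriv (y i)))"
    if "i \<in> {1..3} - {1..r}" for i
    using that hom by (auto simp: log_form_def univ_ring_hom_iff c_def mult_ac)
  have "c * S = fps_X * ((\<Sum>i=1..r. \<gamma> (?\<omega> i) * fps_deriv (y i))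
      + (\<Sum>i\<in>{1..3} - {1..r}. \<gamma> (?\<omega> i) * fps_deriv (y i)))"
    by (simp only: S_def distrib_left sum_distrib_left log_part regular_part cong: sum.cong)
  also have "\<dots> = fps_X * pullback \<gamma> ?\<omega>"
    using \<open>r \<le> 3\<close> sum.subset_diff[of "{1..r}" "{1..3}" "\<lambda>i. \<gamma> (?\<omega> i) * fps_deriv (y i)"]
    by (simp add: pullback_def y_def add.commute)
  finally have "c * S = 0"
    using tangential by simp
  \<comment> \<open>The image of the unit \<open>u\<close> is a unit, so \<open>c\<close> can be
    cancelled.\<close>
  moreover have "c \<noteq> 0"
    using univ_ring_hom_dvd_one[OF hom u] f0 by (auto simp: c_def)
  ultimately have "S = 0"
    by simp
  then have "0 = fps_nth S 0"
    by simp
  \<comment> \<open>The terms with \<open>h\<close> carry a factor \<open>t\<close> and contribute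
    nothing to the residue.\<close>
  also have "\<dots> = (\<Sum>i=1..r. \<iota> (lam i) * of_nat (subdegree (y i)))"
    by (simp add: S_def fps_sum_nth w0)
  also have "\<dots> = \<iota> (\<Sum>i=1..r. of_nat (subdegree (y i)) * lam i)"
    using \<iota>hom univ_ring_hom_of_nat[OF \<iota>hom]
    by (simp add: univ_ring_hom_sum univ_ring_hom_iff mult.commute)
  finally have "(\<Sum>i=1..r. of_nat (subdegree (y i)) * lam i) = 0"
    using univ_ring_hom_field_eq_0_iff[OF \<iota>hom] by metis
  then have ord0: "\<forall>i\<in>{1..r}. subdegree (y i) = 0"
    using nonres[unfolded positive_nonresonant_def, rule_format, of "\<lambda>i. subdegree (y i)"] by blast
  \<comment> \<open>The centre lies on \<open>f = 0\<close>, so some \<open>y i\<close> has zero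
    constant coefficient; being non-zero, it has positive order, against
    \<open>ord0\<close>.\<close>
  have "(\<Prod>i=1..r. fps_nth (y i) 0) = fps_nth (\<gamma> (inv_eq r)) 0"
    unfolding f by (rule sym, induction r) simp_all
  also have "\<dots> = 0"
    using center by (simp add: arc_center_def)
  finally obtain i where i: "i \<in> {1..r}" "fps_nth (y i) 0 = 0"
    by auto
  then show False
    using ord0 y0 nth_subdegree_nonzero by metis
qed

theorem theorem4p1:
  fixes r :: nat and u :: fps3 and lam :: "nat \<Rightarrow> complex" and h :: "nat \<Rightarrow> fps3"
    and \<omega> :: form3 and \<iota> :: "complex \<Rightarrow> 'k::field"
  assumes "1 \<le> r" and "r \<le> 3"
    and "u dvd 1"
    and "\<forall>i\<in>{1..r}. lam i \<noteq> 0"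
    and "positive_nonresonant r lam"
    and "\<omega> = log_form r u lam h"
    and "foliation_generator \<omega>"
    and "field_extension \<iota>"
  shows "(\<forall>Z. zariski_closed Z \<and> Z \<subseteq> D_inv r \<longrightarrow>
            J_tan \<iota> \<omega> Z = J_D_inv \<iota> r Z \<and>
            (\<forall>\<gamma> \<in> J_tan \<iota> \<omega> Z. \<gamma> \<in> arcs_D_inv \<iota> r)) \<and>
         (\<forall>\<gamma> \<in> arcs_D_inv \<iota> r. pullback \<gamma> \<omega> = 0) \<and>
         J_tan \<iota> \<omega> (Sigma_tan r \<omega>) = J_D_inv \<iota> r (Sigma_tan r \<omega>)"
proof -
  have "J_tan \<iota> \<omega> Z = J_D_inv \<iota> r Z" "\<forall>\<gamma> \<in> J_tan \<iota> \<omega> Z. \<gamma> \<in> arcs_D_inv \<iota> r"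
    if "Z \<subseteq> D_inv r" for Z
  proof -
    \<comment> \<open>A point of \<open>D_inv r\<close> is a prime ideal containing
      \<open>inv_eq r\<close>.\<close>
    have center: "inv_eq r \<in> arc_center \<gamma>" if "arc_center \<gamma> \<in> Z" for \<gamma> :: "fps3 \<Rightarrow> 'k fps"
      using \<open>Z \<subseteq> D_inv r\<close> that by (auto simp: D_inv_def zero_locus_def)
    show tan: "\<forall>\<gamma> \<in> J_tan \<iota> \<omega> Z. \<gamma> \<in> arcs_D_inv \<iota> r"
      using tangential_arc_on_D_inv[OF assms(8,3,2,5)] center by (auto simp: J_tan_def assms(6))
    then show "J_tan \<iota> \<omega> Z = J_D_inv \<iota> r Z"
      by (auto simp: J_tan_def J_D_inv_def assms(6) pullback_log_form_on_D_inv)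
        (simp add: arcs_D_inv_iff)
  qed
  moreover have "\<forall>\<gamma> \<in> arcs_D_inv \<iota> r. pullback \<gamma> \<omega> = 0"
    by (simp add: assms(6) pullback_log_form_on_D_inv)
  \<comment> \<open>The last claim is the instance \<open>Z = Sigma_tan r \<omega>\<close> of the
    equality above.\<close>
  moreover have "Sigma_tan r \<omega> \<subseteq> D_inv r"
    by (simp add: Sigma_tan_def)
  ultimately show ?thesis
    by blast
qed

end
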